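(* Let $(X,A,m,\alpha,r)$ be a reversible micro-macro system such that $r$ preserves entropy, let $n\ge1$, and let $q\in\mathrm{Prob}(A)$ be constant on the communication classes of the stochastic matrix $[r\alpha^n]$. (a) $\sigma_n(r\alpha^n i)=-\sigma_n(i)$ for all $i\in X$, and thus $|r\alpha^n i|=e^{-n\sigma_n(r\alpha^n i)}|i|$. (b) $\mathrm{w}_n^q(x)=e^{nx}\mathrm{w}_n^q(-x)$ for all $x\in\mathbb{R}$. (c) $\sigma_n^q=\sum_{x\in\mathbb{R}_{>0}}x(1-e^{-nx})\mathrm{w}_n^q(x)\ge0$ (a finite sum). (d) $\sigma_n^q=0$ if and only if $\alpha^n$ preserves entropy on $\bigsqcup_{a\in A,\,q_a\ne0}a$, i.e. $S(\alpha^n i)=S(i)$ for all $i$ in macrostates $a$ with $q_a\neq0$. (e) For the uniform probability $u_a=1/|A|$ on $A$, $\sigma_n^u>0$ if and only if there is a microstate $i$ with $S(\alpha^n i)\ne S(i)$.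
   Context: A micro-macro system $(X,A,m,\alpha)$ consists of finite sets $X$, $A$, a bijection $\alpha:X\to X$ and a surjection $m:X\to A$; identify $a\in A$ with $m^{-1}(a)$, $|a|=|m^{-1}(a)|$, $|i|=|m(i)|$, $S(a)=\ln|a|$, $S(i)=\ln|m(i)|$. It is reversible with reversion $r:X\to X$ if $r^2=\mathrm{id}$ and $\alpha^{-1}=r\alpha r$; $r$ preserves entropy if $S(ri)=S(i)$ for all $i$. For a bijection $\beta:X\to X$, $[\beta]$ is the stochastic matrix on $A$ with $[\beta]_{ab}=|\{i\in a:\beta(i)\in b\}|/|a|$; its communication classes are the classes of the relation "$a$ and $b$ are reachable from each other". $(cq)_i=q_{m(i)}/|m(i)|$. $\sigma_n(i)=\frac1n(S(\alpha^ni)-S(i))$, $\sigma_n^q=\sum_i(cq)_i\sigma_n(i)$, and $\mathrm{w}_n^q(x)=\sum_{i:\sigma_n(i)=x}(cq)_i$ is the distribution of $\sigma_n$ under $cq$. *)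

theory Defs
  imports Complex_Main
begin

locale micro_macro_system =
  fixes X :: "'x set" and A :: "'a set" and m :: "'x \<Rightarrow> 'a" and \<alpha> :: "'x \<Rightarrow> 'x"
  assumes finite_X: "finite X"
    and finite_A: "finite A"
    and bij_\<alpha>: "bij_betw \<alpha> X X"
    and surj_m: "m ` X = A"

locale reversible_micro_macro_system = micro_macro_system +
  fixes r :: "'x \<Rightarrow> 'x"
  assumes r_closed: "r ` X \<subseteq> X"
    and r_involution: "\<forall>i\<in>X. r (r i) = i"
    and r_reversion: "\<forall>i\<in>X. inv_into X \<alpha> i = r (\<alpha> (r i))"

definition block :: "'x set \<Rightarrow> ('x \<Rightarrow> 'a) \<Rightarrow> 'a \<Rightarrow> 'x set" where
  "block X m a = {i \<in> X. m i = a}"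

definition macro_size :: "'x set \<Rightarrow> ('x \<Rightarrow> 'a) \<Rightarrow> 'a \<Rightarrow> real" where
  "macro_size X m a = real (card (block X m a))"

definition micro_size :: "'x set \<Rightarrow> ('x \<Rightarrow> 'a) \<Rightarrow> 'x \<Rightarrow> real" where
  "micro_size X m i = macro_size X m (m i)"

definition entropy :: "'x set \<Rightarrow> ('x \<Rightarrow> 'a) \<Rightarrow> 'x \<Rightarrow> real" where
  "entropy X m i = ln (micro_size X m i)"

definition preserves_entropy_on ::
  "'x set \<Rightarrow> ('x \<Rightarrow> 'a) \<Rightarrow> ('x \<Rightarrow> 'x) \<Rightarrow> 'x set \<Rightarrow> bool" where
  "preserves_entropy_on X m \<beta> Y \<longleftrightarrow> (\<forall>i\<in>Y. entropy X m (\<beta> i) = entropy X m i)"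

definition prob_vectors :: "'a set \<Rightarrow> ('a \<Rightarrow> real) set" where
  "prob_vectors A = {q. (\<forall>a\<in>A. 0 \<le> q a) \<and> (\<Sum>a\<in>A. q a) = 1}"

definition transition_matrix ::
  "'x set \<Rightarrow> ('x \<Rightarrow> 'a) \<Rightarrow> ('x \<Rightarrow> 'x) \<Rightarrow> 'a \<Rightarrow> 'a \<Rightarrow> real" where
  "transition_matrix X m \<beta> a b =
     real (card {i \<in> block X m a. \<beta> i \<in> block X m b}) / macro_size X m a"

text \<open>Reachability allows zero steps, so every state communicates with itself.\<close>

definition reachable :: "'a set \<Rightarrow> ('a \<Rightarrow> 'a \<Rightarrow> real) \<Rightarrow> 'a rel" where
  "reachable A P = {(a, b) \<in> A \<times> A. P a b > 0}\<^sup>*"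

definition communication_classes :: "'a set \<Rightarrow> ('a \<Rightarrow> 'a \<Rightarrow> real) \<Rightarrow> 'a set set" where
  "communication_classes A P =
     A // {(a, b) \<in> A \<times> A. (a, b) \<in> reachable A P \<and> (b, a) \<in> reachable A P}"

definition coarse_lift :: "'x set \<Rightarrow> ('x \<Rightarrow> 'a) \<Rightarrow> ('a \<Rightarrow> real) \<Rightarrow> 'x \<Rightarrow> real" where
  "coarse_lift X m q i = q (m i) / micro_size X m i"

definition entropy_rate ::
  "'x set \<Rightarrow> ('x \<Rightarrow> 'a) \<Rightarrow> ('x \<Rightarrow> 'x) \<Rightarrow> nat \<Rightarrow> 'x \<Rightarrow> real" where
  "entropy_rate X m \<alpha> n i = (1 / real n) * (entropy X m ((\<alpha> ^^ n) i) - entropy X m i)"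

definition mean_entropy_rate ::
  "'x set \<Rightarrow> ('x \<Rightarrow> 'a) \<Rightarrow> ('x \<Rightarrow> 'x) \<Rightarrow> nat \<Rightarrow> ('a \<Rightarrow> real) \<Rightarrow> real" where
  "mean_entropy_rate X m \<alpha> n q =
     (\<Sum>i\<in>X. coarse_lift X m q i * entropy_rate X m \<alpha> n i)"

definition entropy_rate_dist ::
  "'x set \<Rightarrow> ('x \<Rightarrow> 'a) \<Rightarrow> ('x \<Rightarrow> 'x) \<Rightarrow> nat \<Rightarrow> ('a \<Rightarrow> real) \<Rightarrow> real \<Rightarrow> real" where
  "entropy_rate_dist X m \<alpha> n q x =
     (\<Sum>i\<in>{i \<in> X. entropy_rate X m \<alpha> n i = x}. coarse_lift X m q i)"

end

theory Submission
  imports Defs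
begin

text \<open>
  The map \<open>\<tau> = r \<circ> \<alpha>\<^sup>n\<close> is an involution that changes the sign of
  \<open>\<sigma>\<^sub>n\<close>, so \<open>i\<close> and \<open>\<tau> i\<close> lie in communicating macrostates and
  \<open>q\<close> gives both the same weight; hence \<open>(cq)(\<tau> i) = exp (- n \<sigma>\<^sub>n(i)) (cq)(i)\<close>. Reindexing
  sums over microstates along \<open>\<tau>\<close> gives the fluctuation relation, and pairing each
  \<open>i\<close> with \<open>\<sigma>\<^sub>n(i) < 0\<close> with \<open>\<tau> i\<close> writes the mean entropy rate as a
  sum of nonnegative terms over the \<open>i\<close> with \<open>\<sigma>\<^sub>n(i) > 0\<close>.
\<close>

section \<open>Block sizes and communicating macrostates\<close>

context micro_macro_system
begin

lemma micro_size_pos: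
  assumes "i \<in> X"
  shows "micro_size X m i > 0"
proof -
  have "i \<in> block X m (m i)" "finite (block X m (m i))"
    using assms finite_X by (auto simp: block_def)
  then show ?thesis
    unfolding micro_size_def macro_size_def by (auto simp: card_gt_0_iff)
qed

lemma exp_entropy: "i \<in> X \<Longrightarrow> exp (entropy X m i) = micro_size X m i"
  by (simp add: entropy_def micro_size_pos)

lemma transition_matrix_pos:
  assumes "i \<in> X" "\<beta> i \<in> X"
  shows "transition_matrix X m \<beta> (m i) (m (\<beta> i)) > 0"
proof -
  have "i \<in> {j \<in> block X m (m i). \<beta> j \<in> block X m (m (\<beta> i))}"
    using assms by (auto simp: block_def)
  moreover have "finite {j \<in> block X m (m i). \<beta> j \<in> block X m (m (\<beta> i))}"
    using finite_X by (auto simp: block_def)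
  ultimately have "card {j \<in> block X m (m i). \<beta> j \<in> block X m (m (\<beta> i))} > 0"
    by (auto simp: card_gt_0_iff)
  then show ?thesis
    using micro_size_pos[OF assms(1)] by (simp add: transition_matrix_def micro_size_def)
qed

text \<open>The microstate \<open>i\<close> witnesses a positive entry from \<open>m i\<close> to
  \<open>m (\<beta> i)\<close>. Since \<open>\<beta> (\<beta> i) = i\<close>, the microstate
  \<open>\<beta> i\<close> witnesses one back, so the two macrostates share a class.\<close>

lemma communicating_involution:
  assumes inv: "\<And>i. i \<in> X \<Longrightarrow> \<beta> i \<in> X" "\<And>i. i \<in> X \<Longrightarrow> \<beta> (\<beta> i) = i"
    and const: "\<forall>C \<in> communication_classes A (transition_matrix X m \<beta>). \<forall>a\<in>C. \<forall>b\<in>C. q a = q b"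
    and i: "i \<in> X"
  shows "q (m (\<beta> i)) = q (m i)"
proof -
  define P where "P = transition_matrix X m \<beta>"
  define R where "R = {(a, b) \<in> A \<times> A. (a, b) \<in> reachable A P \<and> (b, a) \<in> reachable A P}"
  have A: "m i \<in> A" "m (\<beta> i) \<in> A"
    using i inv surj_m by auto
  have "P (m i) (m (\<beta> i)) > 0" "P (m (\<beta> i)) (m i) > 0"
    using transition_matrix_pos[of i \<beta>] transition_matrix_pos[of "\<beta> i" \<beta>] i inv
    by (auto simp: P_def)
  then have "(m i, m (\<beta> i)) \<in> reachable A P" "(m (\<beta> i), m i) \<in> reachable A P"
    using A unfolding reachable_def by auto
  then have "m i \<in> R `` {m i}" "m (\<beta> i) \<in> R `` {m i}"
    using A by (auto simp: R_def reachable_def)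
  moreover have "R `` {m i} \<in> communication_classes A P"
    using A by (auto simp: communication_classes_def R_def quotient_def)
  ultimately show ?thesis
    using const unfolding P_def by metis
qed

end

section \<open>Reversal of the iterated dynamics\<close>

context reversible_micro_macro_system
begin

lemma funpow_closed: "i \<in> X \<Longrightarrow> (\<alpha> ^^ n) i \<in> X"
  using bij_\<alpha> by (induction n) (auto simp: bij_betw_def)

lemma r_in: "i \<in> X \<Longrightarrow> r i \<in> X"
  using r_closed by auto

text \<open>The reversion identity at \<open>\<alpha> i\<close> reads
  \<open>i = r (\<alpha> (r (\<alpha> i)))\<close>; applying \<open>r\<close> to both sides removes
  the outer \<open>r\<close>.\<close>

lemma step_reversal:
  assumes "i \<in> X"
  shows "\<alpha> (r (\<alpha> i)) = r i"
proof -
  have X: "\<alpha> i \<in> X" "\<alpha> (r (\<alpha> i)) \<in> X"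
    using assms funpow_closed[of _ 1] r_in by auto
  have "i = inv_into X \<alpha> (\<alpha> i)"
    using assms bij_\<alpha> by (simp add: bij_betw_def)
  also have "\<dots> = r (\<alpha> (r (\<alpha> i)))"
    using r_reversion X by auto
  finally show ?thesis
    using r_involution X by metis
qed

lemma funpow_reversal: "i \<in> X \<Longrightarrow> (\<alpha> ^^ n) (r ((\<alpha> ^^ n) i)) = r i"
proof (induction n)
  case (Suc n)
  \<comment> \<open>The extra \<alpha> of the outer power is moved next to \<open>r\<close>, so that
    \<open>step_reversal\<close> cancels the two innermost \<alpha> before the induction hypothesis
    applies.\<close>
  have "(\<alpha> ^^ Suc n) (r ((\<alpha> ^^ Suc n) i)) = (\<alpha> ^^ n) (\<alpha> (r (\<alpha> ((\<alpha> ^^ n) i))))"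
    by (simp add: funpow_swap1)
  then show ?case
    using Suc by (simp add: step_reversal funpow_closed)
qed simp

end

section \<open>Entropy along the involution \<tau>\<close>

locale entropy_preserving_reversal = reversible_micro_macro_system +
  fixes n :: nat
  assumes r_entropy: "preserves_entropy_on X m r X"
    and n_pos: "n \<ge> 1"
begin

text \<open>In this locale \<open>'a\<close> is the type of microstates; macrostates have type
  \<open>'b\<close>.\<close>

definition \<tau> :: "'a \<Rightarrow> 'a" where
  "\<tau> i = r ((\<alpha> ^^ n) i)"

abbreviation \<sigma> :: "'a \<Rightarrow> real" where
  "\<sigma> \<equiv> entropy_rate X m \<alpha> n"

lemma \<tau>_in: "i \<in> X \<Longrightarrow> \<tau> i \<in> X"
  by (simp add: \<tau>_def r_in funpow_closed)

lemma \<tau>_involution: "i \<in> X \<Longrightarrow> \<tau> (\<tau> i) = i"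
  using r_involution by (simp add: \<tau>_def funpow_reversal)

lemma entropy_\<tau>:
  assumes "i \<in> X"
  shows "entropy X m (\<tau> i) = entropy X m i + real n * \<sigma> i"
  using assms r_entropy n_pos
  by (auto simp: \<tau>_def preserves_entropy_on_def entropy_rate_def funpow_closed)

text \<open>The entropy gains along the loop from \<open>i\<close> to \<open>\<tau> i\<close> and
  back to \<open>i\<close> add up to zero.\<close>

lemma entropy_rate_\<tau>:
  assumes "i \<in> X"
  shows "\<sigma> (\<tau> i) = - \<sigma> i"
proof -
  have "real n * \<sigma> (\<tau> i) = real n * (- \<sigma> i)"
    using entropy_\<tau>[OF assms] entropy_\<tau>[OF \<tau>_in[OF assms]] \<tau>_involution[OF assms] by simp
  then show ?thesis
    using n_pos by (subst (asm) mult_cancel_left) auto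
qed

lemma micro_size_\<tau>:
  assumes "i \<in> X"
  shows "micro_size X m (\<tau> i) = exp (real n * \<sigma> i) * micro_size X m i"
proof -
  have "micro_size X m (\<tau> i) = exp (entropy X m i + real n * \<sigma> i)"
    using exp_entropy[OF \<tau>_in[OF assms]] entropy_\<tau>[OF assms] by simp
  then show ?thesis
    using exp_entropy[OF assms] by (simp add: exp_add)
qed

end

section \<open>Fluctuation relation and mean rate for \<tau>-invariant weights\<close>

locale reversal_invariant_weight = entropy_preserving_reversal +
  fixes q :: "'b \<Rightarrow> real"
  assumes q_nonneg: "a \<in> A \<Longrightarrow> q a \<ge> 0"
    and q_\<tau>: "i \<in> X \<Longrightarrow> q (m (\<tau> i)) = q (m i)"
begin

abbreviation cq :: "'a \<Rightarrow> real" where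
  "cq \<equiv> coarse_lift X m q"

abbreviation w :: "real \<Rightarrow> real" where
  "w \<equiv> entropy_rate_dist X m \<alpha> n q"

lemma cq_nonneg: "i \<in> X \<Longrightarrow> cq i \<ge> 0"
  using surj_m by (auto simp: coarse_lift_def intro!: divide_nonneg_pos q_nonneg micro_size_pos)

lemma cq_\<tau>: "i \<in> X \<Longrightarrow> cq (\<tau> i) = exp (- real n * \<sigma> i) * cq i"
  by (simp add: coarse_lift_def q_\<tau> micro_size_\<tau> exp_minus field_simps)

text \<open>Since \<tau> is its own inverse and negates \<sigma>, it swaps the two index sets. A
  singleton \<open>Y\<close> serves the fluctuation relation, the positive half-line serves the mean
  rate.\<close>

lemma sum_reindex_\<tau>:
  fixes f :: "'a \<Rightarrow> real"
  shows "(\<Sum>i | i \<in> X \<and> \<sigma> i \<in> Y. f (\<tau> i)) = (\<Sum>i | i \<in> X \<and> - \<sigma> i \<in> Y. f i)"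
  by (rule sum.reindex_bij_witness[where i = \<tau> and j = \<tau>])
    (auto simp: \<tau>_in \<tau>_involution entropy_rate_\<tau>)

lemma entropy_rate_dist_symmetry: "w x = exp (real n * x) * w (- x)"
proof -
  have "w (- x) = (\<Sum>i | i \<in> X \<and> - \<sigma> i \<in> {x}. cq i)"
    unfolding entropy_rate_dist_def by (rule sum.cong) auto
  also have "\<dots> = (\<Sum>i | i \<in> X \<and> \<sigma> i \<in> {x}. cq (\<tau> i))"
    by (rule sum_reindex_\<tau>[symmetric])
  also have "\<dots> = (\<Sum>i | i \<in> X \<and> \<sigma> i \<in> {x}. exp (- real n * x) * cq i)"
    by (rule sum.cong) (auto simp: cq_\<tau>)
  also have "\<dots> = exp (- real n * x) * w x"
    by (simp add: entropy_rate_dist_def sum_distrib_left)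
  finally show ?thesis
    by (simp add: exp_minus)
qed

text \<open>Microstates with rate zero contribute nothing. The negative ones are carried by \<tau>
  to the positive ones, where they contribute the term with the factor
  \<open>- exp (- real n * \<sigma> i)\<close>.\<close>

lemma mean_entropy_rate_microstates:
  "mean_entropy_rate X m \<alpha> n q =
     (\<Sum>i | i \<in> X \<and> \<sigma> i > 0. \<sigma> i * (1 - exp (- real n * \<sigma> i)) * cq i)"
proof -
  have "mean_entropy_rate X m \<alpha> n q =
      (\<Sum>i\<in>{i \<in> X. \<sigma> i > 0} \<union> {i \<in> X. \<sigma> i < 0}. cq i * \<sigma> i)"
    unfolding mean_entropy_rate_def using finite_X by (intro sum.mono_neutral_right) auto
  also have "\<dots> = (\<Sum>i | i \<in> X \<and> \<sigma> i > 0. cq i * \<sigma> i) + (\<Sum>i | i \<in> X \<and> \<sigma> i < 0. cq i * \<sigma> i)"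
    using finite_X by (intro sum.union_disjoint) auto
  also have "(\<Sum>i | i \<in> X \<and> \<sigma> i < 0. cq i * \<sigma> i) = (\<Sum>i | i \<in> X \<and> \<sigma> i > 0. cq (\<tau> i) * \<sigma> (\<tau> i))"
    using sum_reindex_\<tau>[where Y = "{0<..}" and f = "\<lambda>i. cq i * \<sigma> i"] by simp
  also have "(\<Sum>i | i \<in> X \<and> \<sigma> i > 0. cq i * \<sigma> i) + \<dots> =
      (\<Sum>i | i \<in> X \<and> \<sigma> i > 0. \<sigma> i * (1 - exp (- real n * \<sigma> i)) * cq i)"
    unfolding sum.distrib[symmetric]
    by (rule sum.cong) (auto simp: cq_\<tau> entropy_rate_\<tau> algebra_simps)
  finally show ?thesis .
qed

text \<open>Only a rate attained by some microstate can carry weight; this makes the sum over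
  positive reals finite.\<close>

lemma support_entropy_rate_dist: "{x. 0 < x \<and> w x \<noteq> 0} \<subseteq> \<sigma> ` {i \<in> X. \<sigma> i > 0}"
proof
  fix x assume x: "x \<in> {x. 0 < x \<and> w x \<noteq> 0}"
  then obtain i where "i \<in> X" "\<sigma> i = x"
    unfolding entropy_rate_dist_def mem_Collect_eq by (blast elim: sum.not_neutral_contains_not_neutral)
  with x show "x \<in> \<sigma> ` {i \<in> X. \<sigma> i > 0}"
    by auto
qed

lemma finite_support_entropy_rate_dist: "finite {x. 0 < x \<and> w x \<noteq> 0}"
  using finite_subset[OF support_entropy_rate_dist] finite_X by simp

lemma mean_entropy_rate_dist:
  "mean_entropy_rate X m \<alpha> n q =
     (\<Sum>x\<in>{x. 0 < x \<and> w x \<noteq> 0}. x * (1 - exp (- real n * x)) * w x)"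
proof -
  define f where "f x = x * (1 - exp (- real n * x))" for x
  let ?P = "{i \<in> X. \<sigma> i > 0}"
  have fin: "finite ?P"
    using finite_X by simp
  have "mean_entropy_rate X m \<alpha> n q = (\<Sum>i\<in>?P. f (\<sigma> i) * cq i)"
    by (simp add: mean_entropy_rate_microstates f_def)
  also have "\<dots> = (\<Sum>x\<in>\<sigma> ` ?P. \<Sum>i | i \<in> ?P \<and> \<sigma> i = x. f (\<sigma> i) * cq i)"
    by (rule sum.image_gen[OF fin])
  also have "\<dots> = (\<Sum>x\<in>\<sigma> ` ?P. f x * w x)"
    by (intro sum.cong refl) (auto simp: entropy_rate_dist_def sum_distrib_left intro!: sum.cong)
  \<comment> \<open>The values dropped here are attained rates whose total weight is zero.\<close>
  also have "\<dots> = (\<Sum>x | 0 < x \<and> w x \<noteq> 0. f x * w x)"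
    using fin support_entropy_rate_dist by (intro sum.mono_neutral_right) auto
  finally show ?thesis
    by (simp add: f_def)
qed

lemma summand_pos: "\<sigma> i > 0 \<Longrightarrow> \<sigma> i * (1 - exp (- real n * \<sigma> i)) > 0"
  using n_pos by simp

lemma summand_nonneg:
  "i \<in> X \<Longrightarrow> \<sigma> i > 0 \<Longrightarrow> \<sigma> i * (1 - exp (- real n * \<sigma> i)) * cq i \<ge> 0"
  using summand_pos[of i] cq_nonneg[of i] by (intro mult_nonneg_nonneg[OF less_imp_le])

lemma mean_entropy_rate_nonneg: "mean_entropy_rate X m \<alpha> n q \<ge> 0"
  unfolding mean_entropy_rate_microstates using summand_nonneg by (intro sum_nonneg) auto

text \<open>A sum of nonnegative terms vanishes only termwise. This forces
  \<open>q (m i) = 0\<close> wherever the rate is positive, and the symmetry under \<tau> extends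
  this to negative rates.\<close>

lemma mean_entropy_rate_eq_0_iff:
  "mean_entropy_rate X m \<alpha> n q = 0
     \<longleftrightarrow> (\<forall>i\<in>X. q (m i) \<noteq> 0 \<longrightarrow> entropy X m ((\<alpha> ^^ n) i) = entropy X m i)"
proof -
  have "mean_entropy_rate X m \<alpha> n q = 0
      \<longleftrightarrow> (\<forall>i\<in>{i \<in> X. \<sigma> i > 0}. \<sigma> i * (1 - exp (- real n * \<sigma> i)) * cq i = 0)"
    unfolding mean_entropy_rate_microstates using finite_X summand_nonneg
    by (intro sum_nonneg_eq_0_iff) auto
  also have "\<dots> \<longleftrightarrow> (\<forall>i\<in>X. \<sigma> i > 0 \<longrightarrow> q (m i) = 0)"
  proof -
    have "cq i = 0 \<longleftrightarrow> q (m i) = 0" if "i \<in> X" for i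
      using micro_size_pos[OF that] by (simp add: coarse_lift_def)
    moreover have "\<sigma> i * (1 - exp (- real n * \<sigma> i)) \<noteq> 0" if "\<sigma> i > 0" for i
      using summand_pos[OF that] by linarith
    ultimately show ?thesis
      \<comment> \<open>Only the outer product is split, so that the coefficient stays whole and
        matches the fact that it is nonzero.\<close>
      by (auto simp del: mult_eq_0_iff simp add: mult_eq_0_iff[of "_ * (1 - _)"])
  qed
  also have "\<dots> \<longleftrightarrow> (\<forall>i\<in>X. q (m i) \<noteq> 0 \<longrightarrow> \<sigma> i = 0)"
  proof (intro iffI ballI impI)
    fix i assume *: "\<forall>i\<in>X. \<sigma> i > 0 \<longrightarrow> q (m i) = 0" and i: "i \<in> X" "q (m i) \<noteq> 0"
    then have "\<not> \<sigma> i > 0" "\<not> \<sigma> (\<tau> i) > 0"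
      using \<tau>_in q_\<tau> by metis+
    then show "\<sigma> i = 0"
      using entropy_rate_\<tau>[OF i(1)] by linarith
  qed force
  also have "\<dots> \<longleftrightarrow> (\<forall>i\<in>X. q (m i) \<noteq> 0 \<longrightarrow> entropy X m ((\<alpha> ^^ n) i) = entropy X m i)"
    using n_pos by (simp add: entropy_rate_def)
  finally show ?thesis .
qed

end

theorem theorem24:
  fixes X :: "'x set" and A :: "'a set" and m :: "'x \<Rightarrow> 'a"
    and \<alpha> r :: "'x \<Rightarrow> 'x" and n :: nat and q :: "'a \<Rightarrow> real"
  assumes "reversible_micro_macro_system X A m \<alpha> r"
    and "preserves_entropy_on X m r X"
    and "n \<ge> 1"
    and "q \<in> prob_vectors A"
    and "\<forall>C \<in> communication_classes A (transition_matrix X m (r \<circ> (\<alpha> ^^ n))).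
           \<forall>a\<in>C. \<forall>b\<in>C. q a = q b"
  shows "(\<forall>i\<in>X. entropy_rate X m \<alpha> n (r ((\<alpha> ^^ n) i)) = - entropy_rate X m \<alpha> n i
           \<and> micro_size X m (r ((\<alpha> ^^ n) i))
             = exp (- real n * entropy_rate X m \<alpha> n (r ((\<alpha> ^^ n) i))) * micro_size X m i)
    \<and> (\<forall>x. entropy_rate_dist X m \<alpha> n q x
           = exp (real n * x) * entropy_rate_dist X m \<alpha> n q (- x))
    \<and> (finite {x. 0 < x \<and> entropy_rate_dist X m \<alpha> n q x \<noteq> 0}
       \<and> mean_entropy_rate X m \<alpha> n q
           = (\<Sum>x\<in>{x. 0 < x \<and> entropy_rate_dist X m \<alpha> n q x \<noteq> 0}.
                x * (1 - exp (- real n * x)) * entropy_rate_dist X m \<alpha> n q x)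
       \<and> mean_entropy_rate X m \<alpha> n q \<ge> 0)
    \<and> (mean_entropy_rate X m \<alpha> n q = 0
         \<longleftrightarrow> preserves_entropy_on X m (\<alpha> ^^ n) (\<Union>a\<in>{a \<in> A. q a \<noteq> 0}. block X m a))
    \<and> (mean_entropy_rate X m \<alpha> n (\<lambda>a. 1 / real (card A)) > 0
         \<longleftrightarrow> (\<exists>i\<in>X. entropy X m ((\<alpha> ^^ n) i) \<noteq> entropy X m i))"
proof -
  interpret entropy_preserving_reversal X A m \<alpha> r n
    using assms(1-3)
    by (simp add: entropy_preserving_reversal_def entropy_preserving_reversal_axioms_def)
  have \<tau>: "r \<circ> (\<alpha> ^^ n) = \<tau>"
    by (auto simp: \<tau>_def)
  interpret q: reversal_invariant_weight X A m \<alpha> r n q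
  proof
    show "q (m (\<tau> i)) = q (m i)" if "i \<in> X" for i
      by (rule communicating_involution[OF \<tau>_in \<tau>_involution assms(5)[unfolded \<tau>] that])
  qed (use assms(4) in \<open>auto simp: prob_vectors_def\<close>)
  \<comment> \<open>A constant weight is trivially \<tau>-invariant.\<close>
  interpret u: reversal_invariant_weight X A m \<alpha> r n "\<lambda>a. 1 / real (card A)"
    by unfold_locales auto
  \<comment> \<open>An empty sum could not equal 1. This excludes the default value
    \<open>1 / 0 = 0\<close> for the uniform weight.\<close>
  have "A \<noteq> {}"
    using assms(4) by (auto simp: prob_vectors_def)
  then have card: "1 / real (card A) \<noteq> 0"
    using finite_A by simp
  show ?thesis
  proof (intro conjI ballI allI)
    fix i assume "i \<in> X"
    then show "\<sigma> (r ((\<alpha> ^^ n) i)) = - \<sigma> i"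
      and "micro_size X m (r ((\<alpha> ^^ n) i))
        = exp (- real n * \<sigma> (r ((\<alpha> ^^ n) i))) * micro_size X m i"
      using entropy_rate_\<tau>[of i] micro_size_\<tau>[of i] by (simp_all add: \<tau>_def)
  next
    show "mean_entropy_rate X m \<alpha> n q = 0
      \<longleftrightarrow> preserves_entropy_on X m (\<alpha> ^^ n) (\<Union>a\<in>{a \<in> A. q a \<noteq> 0}. block X m a)"
      unfolding q.mean_entropy_rate_eq_0_iff preserves_entropy_on_def block_def
      using surj_m by auto
  next
    show "mean_entropy_rate X m \<alpha> n (\<lambda>a. 1 / real (card A)) > 0
      \<longleftrightarrow> (\<exists>i\<in>X. entropy X m ((\<alpha> ^^ n) i) \<noteq> entropy X m i)"
      \<comment> \<open>As every macrostate has nonzero uniform weight, the criterion for a zero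
        mean covers all of \<open>X\<close>; nonnegativity turns nonzero into positive.\<close>
      using u.mean_entropy_rate_eq_0_iff u.mean_entropy_rate_nonneg card
      by (metis less_le)
  qed (fact q.entropy_rate_dist_symmetry q.finite_support_entropy_rate_dist
      q.mean_entropy_rate_dist q.mean_entropy_rate_nonneg)+
qed

end
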